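(* Let $C \subset \mathbb{R}^n$ be a closed set, let $I$ be a nonempty subset of $\{1,\ldots,n\}$, and assume that $\pi(C)$ is unbounded, where $\pi(x) = (x_i)_{i \in I}$. Let $v \in \mathbb{R}^n$. Then $v \in \mathrm{int}\, T_C(\infty_I)$ if and only if there exist constants $\epsilon > 0$, $R > 0$, and $\lambda > 0$ such that $$x + t v' \in C \quad \text{for all } x \in C \setminus \mathbb{B}_{R, I},\ t \in [0, \lambda], \text{ and } v' \in \mathbb{B}_\epsilon(v).$$
   Context: $\mathbb{R}^n$ carries the Euclidean norm $\|\cdot\|$; $\mathbb{B}_\epsilon(v)$ is the closed ball centered at $v$ of radius $\epsilon$. For a nonempty index set $I \subset \{1,\ldots,n\}$, $\pi \colon \mathbb{R}^n \to \mathbb{R}^{\#I}$ is the projection $x \mapsto (x_i)_{i\in I}$, and $\mathbb{B}_{R,I} := \{x \in \mathbb{R}^n \mid \|\pi(x)\| \le R\}$. $\pi(x_k) \to \infty$ means $\|\pi(x_k)\| \to \infty$; $t_k \searrow 0$ means $t_k > 0$ and $t_k$ decreases to $0$. The Clarke tangent cone of $C$ at infinity (with respect to $I$), $T_C(\infty_I)$, is the set of all $v \in \mathbb{R}^n$ such that, for all sequences $x_k \in C$ with $\pi(x_k) \to \infty$ and $t_k \searrow 0$, there exists a sequence $v_k \to v$ with $x_k + t_k v_k \in C$ for all $k$. $\mathrm{int}$ denotes the interior. *)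

theory Defs
  imports "HOL-Analysis.Analysis"
begin

text \<open>
  The projection of $x$ to its coordinates in $I$. Since the size of $I$ is not a type,
  the target space $\mathbb{R}^{\# I}$ is identified with the coordinate subspace
  of $\mathbb{R}^n$ of the vectors that vanish outside $I$. This identification is a linear
  isometry, see \<open>norm_coord_proj\<close>.
\<close>

definition coord_proj :: "'n::finite set \<Rightarrow> real ^ 'n \<Rightarrow> real ^ 'n" where
  "coord_proj I x = (\<chi> i. if i \<in> I then x $ i else 0)"

lemma norm_coord_proj: "norm (coord_proj I x) = sqrt (\<Sum>i\<in>I. (x $ i)\<^sup>2)"
proof -
  have "(\<Sum>i\<in>UNIV. (norm (coord_proj I x $ i))\<^sup>2) = (\<Sum>i\<in>UNIV. if i \<in> I then (x $ i)\<^sup>2 else 0)"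
    by (intro sum.cong) (auto simp: coord_proj_def)
  also have "\<dots> = (\<Sum>i\<in>I. (x $ i)\<^sup>2)"
    by (simp add: sum.If_cases)
  finally show ?thesis
    by (simp add: norm_vec_def L2_set_def)
qed

definition cyl_ball :: "real \<Rightarrow> 'n::finite set \<Rightarrow> (real ^ 'n) set" where
  "cyl_ball R I = {x. norm (coord_proj I x) \<le> R}"

text \<open>Decreasing is understood in the weak sense.\<close>

definition decreases_to_zero :: "(nat \<Rightarrow> real) \<Rightarrow> bool" where
  "decreases_to_zero t \<longleftrightarrow> (\<forall>k. t k > 0) \<and> decseq t \<and> t \<longlonglongrightarrow> 0"

definition clarke_tangent_cone_at_inf :: "'n::finite set \<Rightarrow> (real ^ 'n) set \<Rightarrow> (real ^ 'n) set" where
  "clarke_tangent_cone_at_inf I C =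
    {v. \<forall>x t. (\<forall>k. x k \<in> C) \<and> filterlim (\<lambda>k. norm (coord_proj I (x k))) at_top sequentially \<and>
              decreases_to_zero t \<longrightarrow>
              (\<exists>w. w \<longlonglongrightarrow> v \<and> (\<forall>k. x k + t k *\<^sub>R w k \<in> C))}"

end

theory Submission
  imports Defs
begin

text \<open>
  If \<open>v\<close> lies in the interior of the cone, a compactness argument shows that the sequences in the
  definition of the cone work uniformly: at points of \<open>C\<close> far out in the coordinates \<open>I\<close>, every
  small step in a direction \<open>u\<close> near \<open>v\<close> reaches \<open>C\<close> after an error of at most \<open>\<eta>\<close> in \<open>u\<close>.
  Consequently, if \<open>z\<close> is a point of \<open>C\<close> nearest to \<open>y \<notin> C\<close>, then \<open>(y - z) \<bullet> v' < 0\<close> for \<open>v'\<close> close to \<open>v\<close>,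
  since otherwise a step from \<open>z\<close> in the direction \<open>v + \<delta> (y - z) / \<parallel>y - z\<parallel>\<close> would come closer to \<open>y\<close>.
  Hence the distance to \<open>C\<close> decreases along \<open>s \<mapsto> x + s v'\<close> wherever it is positive; it is
  \<open>0\<close> at \<open>s = 0\<close>, so it stays \<open>0\<close>.
\<close>

lemma coord_proj_add: "coord_proj I (x + y) = coord_proj I x + coord_proj I y"
  by (simp add: coord_proj_def vec_eq_iff)

lemma norm_coord_proj_le: "norm (coord_proj I x) \<le> norm x"
  by (rule norm_le_componentwise_cart) (simp add: coord_proj_def)

lemma norm_coord_proj_le_add_dist: "norm (coord_proj I x) \<le> norm (coord_proj I y) + dist x y"
proof -
  have "norm (coord_proj I x) \<le> norm (coord_proj I y) + norm (coord_proj I (x - y))"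
    using norm_triangle_ineq[of "coord_proj I y" "coord_proj I (x - y)"]
    by (simp flip: coord_proj_add)
  also have "\<dots> \<le> norm (coord_proj I y) + dist x y"
    using norm_coord_proj_le[of I "x - y"] by (simp add: dist_norm)
  finally show ?thesis .
qed

text \<open>Failure of uniformity gives, for each \<open>n\<close>, a bad direction in
  \<open>K\<close>, a base point beyond radius \<open>n\<close> and a step of size at most
  \<open>1 / (n + 1)\<close>. By compactness the bad directions converge along a subsequence to some
  \<open>a\<close> in \<open>K\<close>. The sequence that the cone supplies for \<open>a\<close>
  then also approaches the bad directions, so its error drops below \<open>\<eta>\<close>.\<close>

lemma clarke_tangent_cone_uniform:
  fixes C :: "(real ^ 'n::finite) set"
  assumes K: "compact K" "K \<subseteq> clarke_tangent_cone_at_inf I C" and \<eta>: "\<eta> > 0"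
  obtains R l where "l > 0"
    "\<And>u x t. u \<in> K \<Longrightarrow> x \<in> C \<Longrightarrow> norm (coord_proj I x) > R \<Longrightarrow> 0 < t \<Longrightarrow> t \<le> l \<Longrightarrow>
       \<exists>w. dist w u \<le> \<eta> \<and> x + t *\<^sub>R w \<in> C"
proof (rule ccontr)
  note uniform = that
  assume "\<not> thesis"
  then have fail: "\<exists>u x t. u \<in> K \<and> x \<in> C \<and> norm (coord_proj I x) > R \<and> 0 < t \<and> t \<le> l \<and>
      (\<forall>w. x + t *\<^sub>R w \<in> C \<longrightarrow> \<eta> < dist w u)" if "l > 0" for R l
    using that uniform[of l R] by (meson not_le)
  define P where "P n = (\<lambda>(u, x, t). u \<in> K \<and> x \<in> C \<and> norm (coord_proj I x) > real n \<and> 0 < t \<and>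
      t \<le> inverse (real (Suc n)) \<and> (\<forall>w. x + t *\<^sub>R w \<in> C \<longrightarrow> \<eta> < dist w u))" for n
  \<comment> \<open>Dependent choice makes the steps nonincreasing, as
    \<open>decreases_to_zero\<close> demands; the bounds in \<open>P\<close> alone would only give
    convergence to zero.\<close>
  have "\<exists>f. \<forall>n. P n (f n) \<and> snd (snd (f (Suc n))) \<le> snd (snd (f n))"
  proof (rule dependent_nat_choice)
    show "\<exists>a. P 0 a"
      using fail[of 1 0] by (auto simp: P_def)
    fix a n assume "P n a"
    then have "min (snd (snd a)) (inverse (real (Suc (Suc n)))) > 0"
      by (auto simp: P_def)
    from fail[OF this, of "real (Suc n)"] show "\<exists>b. P (Suc n) b \<and> snd (snd b) \<le> snd (snd a)"
      by (fastforce simp: P_def)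
  qed
  then obtain f where f: "\<And>n. P n (f n)" "\<And>n. snd (snd (f (Suc n))) \<le> snd (snd (f n))"
    by blast
  define u where "u n = fst (f n)" for n
  define x where "x n = fst (snd (f n))" for n
  define t where "t n = snd (snd (f n))" for n
  have uxt: "u n \<in> K" "x n \<in> C" "real n < norm (coord_proj I (x n))" "0 < t n"
    "t n \<le> inverse (real (Suc n))" "\<And>w. x n + t n *\<^sub>R w \<in> C \<Longrightarrow> \<eta> < dist w (u n)" for n
    using f(1)[of n] by (auto simp: P_def u_def x_def t_def split: prod.splits)
  obtain a r where a: "a \<in> K" "strict_mono r" "(u \<circ> r) \<longlonglongrightarrow> a"
    using K(1) uxt(1) unfolding compact_def by meson
  have t_lim: "t \<longlonglongrightarrow> 0"
    by (rule real_tendsto_sandwich[OF _ _ tendsto_const LIMSEQ_inverse_real_of_nat])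
      (use uxt(4,5) in \<open>simp_all add: less_imp_le\<close>)
  have "decseq t"
    using f(2) by (auto simp: decseq_Suc_iff t_def)
  then have "decreases_to_zero (t \<circ> r)"
    using uxt(4) t_lim a(2) LIMSEQ_subseq_LIMSEQ[OF t_lim a(2)]
    by (auto simp: decreases_to_zero_def decseq_def strict_mono_less_eq)
  moreover have "filterlim (\<lambda>k. norm (coord_proj I (x k))) at_top sequentially"
    by (rule filterlim_at_top_mono[OF filterlim_real_sequentially])
      (use uxt(3) in \<open>simp add: less_imp_le\<close>)
  then have "filterlim (\<lambda>k. norm (coord_proj I ((x \<circ> r) k))) at_top sequentially"
    using filterlim_compose[OF _ filterlim_subseq[OF a(2)]] by auto
  moreover have "\<forall>k. (x \<circ> r) k \<in> C"
    using uxt by simp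
  ultimately obtain w where w: "w \<longlonglongrightarrow> a" "\<And>k. (x \<circ> r) k + (t \<circ> r) k *\<^sub>R w k \<in> C"
    using a(1) K(2) unfolding clarke_tangent_cone_at_inf_def by blast
  have "(\<lambda>k. dist (w k) ((u \<circ> r) k)) \<longlonglongrightarrow> 0"
    using tendsto_dist[OF w(1) a(3)] by simp
  then have "\<forall>\<^sub>F k in sequentially. dist (w k) ((u \<circ> r) k) < \<eta>"
    using \<eta> by (rule order_tendstoD)
  then obtain k where "dist (w k) ((u \<circ> r) k) < \<eta>"
    by (auto simp: eventually_sequentially)
  with uxt(6)[of "r k" "w k"] w(2)[of k] show False
    by simp
qed

text \<open>With \<open>n\<close> the unit vector from \<open>z\<close> towards \<open>y\<close>,
  moving from \<open>z\<close> by \<open>s *\<^sub>R w\<close> changes the squared distance to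
  \<open>y\<close> by \<open>- 2 * s * d * (n \<bullet> w) + s\<^sup>2 * (norm w)\<^sup>2\<close>.
  If the claim failed, some \<open>w\<close> leading into \<open>C\<close> would have
  \<open>n \<bullet> w\<close> bounded below by a positive constant, and for small \<open>s\<close>
  the linear term would win.\<close>

lemma inner_neg_of_nearest_point:
  fixes C :: "'a::real_inner set"
  assumes z: "z \<in> C" "y \<notin> C" "\<And>c. c \<in> C \<Longrightarrow> norm (y - z) \<le> norm (y - c)"
    and "\<delta> > 0" "l > 0"
    and step: "\<And>u t. u \<in> cball v \<delta> \<Longrightarrow> 0 < t \<Longrightarrow> t \<le> l \<Longrightarrow>
      \<exists>w. dist w u \<le> \<delta> / 2 \<and> z + t *\<^sub>R w \<in> C"
    and v': "v' \<in> cball v (\<delta> / 4)"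
  shows "(y - z) \<bullet> v' < 0"
proof (rule ccontr)
  assume "\<not> ?thesis"
  then have nonneg: "0 \<le> (y - z) \<bullet> v'" by simp
  define d where "d = norm (y - z)"
  define n where "n = (y - z) /\<^sub>R d"
  \<comment> \<open>An upper bound for the norm of the \<open>w\<close> to come, which lies within
    \<open>\<delta> / 2\<close> of \<open>v + \<delta> *\<^sub>R n\<close>.\<close>
  define M where "M = norm v + 2 * \<delta>"
  have d: "d > 0" using z by (auto simp: d_def)
  have n: "norm n = 1" "y - z = d *\<^sub>R n" using d by (auto simp: n_def d_def)
  have nn: "n \<bullet> n = 1" using n by (simp add: norm_eq_1)
  have M: "M > 0" using \<open>\<delta> > 0\<close> by (simp add: M_def add_nonneg_pos)
  \<comment> \<open>The second bound keeps the quadratic cost per unit of \<open>s\<close> below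
    \<open>d * \<delta> / 4\<close>, which is at most half of the linear gain
    \<open>2 * d * (n \<bullet> w)\<close>.\<close>
  define s where "s = min l (d * \<delta> / (4 * M\<^sup>2))"
  have s: "0 < s" "s \<le> l" "s * M\<^sup>2 \<le> d * \<delta> / 4"
  proof -
    show "0 < s" "s \<le> l" using d M \<open>\<delta> > 0\<close> \<open>l > 0\<close> by (auto simp: s_def)
    have "s * M\<^sup>2 \<le> d * \<delta> / (4 * M\<^sup>2) * M\<^sup>2"
      by (rule mult_right_mono) (auto simp: s_def)
    then show "s * M\<^sup>2 \<le> d * \<delta> / 4" using M by simp
  qed
  have "v + \<delta> *\<^sub>R n \<in> cball v \<delta>"
    using n \<open>\<delta> > 0\<close> by (simp add: dist_norm)
  from step[OF this s(1,2)] obtain w where w: "dist w (v + \<delta> *\<^sub>R n) \<le> \<delta> / 2" "z + s *\<^sub>R w \<in> C"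
    by blast
  have "norm w \<le> norm (v + \<delta> *\<^sub>R n) + norm (w - (v + \<delta> *\<^sub>R n))"
    using norm_triangle_ineq[of "v + \<delta> *\<^sub>R n" "w - (v + \<delta> *\<^sub>R n)"] by simp
  also have "\<dots> \<le> M"
    using norm_triangle_ineq[of v "\<delta> *\<^sub>R n"] w(1) n \<open>\<delta> > 0\<close> by (simp add: M_def dist_norm)
  finally have wM: "(norm w)\<^sup>2 \<le> M\<^sup>2" by (simp add: power_mono)
  \<comment> \<open>Budget for \<open>n \<bullet> w\<close>: the tilt by
    \<open>\<delta> *\<^sub>R n\<close> contributes \<open>\<delta>\<close>, passing from
    \<open>v'\<close> to \<open>v\<close> costs at most \<open>\<delta> / 4\<close> and the error of
    \<open>w\<close> at most \<open>\<delta> / 2\<close>, so \<open>\<delta> / 4\<close>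
    remains.\<close>
  have "0 \<le> n \<bullet> v'"
    using nonneg d by (simp add: n zero_le_mult_iff)
  moreover have "\<bar>n \<bullet> (v' - v)\<bar> \<le> \<delta> / 4"
    using Cauchy_Schwarz_ineq2[of n "v' - v"] n v' by (simp add: dist_norm norm_minus_commute)
  moreover have "\<bar>n \<bullet> (w - (v + \<delta> *\<^sub>R n))\<bar> \<le> \<delta> / 2"
    using Cauchy_Schwarz_ineq2[of n "w - (v + \<delta> *\<^sub>R n)"] n w(1) by (simp add: dist_norm)
  ultimately have nw: "n \<bullet> w \<ge> \<delta> / 4"
    using nn unfolding inner_diff_right inner_add_right inner_scaleR_right abs_le_iff by simp
  have "d\<^sup>2 \<le> (norm (y - (z + s *\<^sub>R w)))\<^sup>2"
    using z(3)[OF w(2)] d by (intro power_mono) (auto simp: d_def)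
  also have "y - (z + s *\<^sub>R w) = d *\<^sub>R n - s *\<^sub>R w"
    using n by (simp add: algebra_simps)
  also have "(norm (d *\<^sub>R n - s *\<^sub>R w))\<^sup>2 = d\<^sup>2 - 2 * (s * (d * (n \<bullet> w))) + s * (s * (norm w)\<^sup>2)"
    using nn unfolding power2_norm_eq_inner
    by (simp add: inner_diff_left inner_diff_right inner_commute power2_eq_square)
  finally have "s * (2 * (d * (n \<bullet> w))) \<le> s * (s * (norm w)\<^sup>2)"
    by simp
  then have "2 * (d * (n \<bullet> w)) \<le> s * (norm w)\<^sup>2"
    using s(1) by (simp only: mult_le_cancel_left_pos)
  also have "\<dots> \<le> s * M\<^sup>2" using wM s(1) by simp
  also have "\<dots> \<le> d * (\<delta> / 4)" using s(3) by simp
  also have "\<dots> \<le> d * (n \<bullet> w)" using nw d by simp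
  finally have "d * (n \<bullet> w) \<le> 0" by simp
  moreover have "d * (n \<bullet> w) > 0" using d nw \<open>\<delta> > 0\<close> by simp
  ultimately show False by simp
qed

text \<open>If the end value were positive, consider the last time \<open>a\<close> at which
  \<open>\<phi>\<close> is at most half of it. By the intermediate value theorem
  \<open>\<phi>\<close> equals that half at \<open>a\<close>, hence is positive there, and
  \<open>dec\<close> yields a later time with a still smaller value.\<close>

lemma nonpos_if_decreasing_where_pos:
  fixes \<phi> :: "real \<Rightarrow> real"
  assumes "0 \<le> t" and cont: "continuous_on {0..t} \<phi>" and "\<phi> 0 \<le> 0"
    and dec: "\<And>s. 0 \<le> s \<Longrightarrow> s < t \<Longrightarrow> \<phi> s > 0 \<Longrightarrow> \<exists>h>0. s + h \<le> t \<and> \<phi> (s + h) < \<phi> s"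
  shows "\<phi> t \<le> 0"
proof (rule ccontr)
  assume "\<not> ?thesis"
  then have pos: "\<phi> t > 0" by simp
  define S where "S = {0..t} \<inter> \<phi> -` {..\<phi> t / 2}"
  have "closed S"
    unfolding S_def by (intro continuous_closed_preimage cont closed_real_atLeastAtMost closed_atMost)
  moreover have "bounded S"
    unfolding S_def by (meson bounded_closed_interval bounded_subset inf_le1)
  ultimately have "compact S" by (simp add: compact_eq_bounded_closed)
  moreover have "0 \<in> S" using assms(1,3) pos by (auto simp: S_def)
  ultimately obtain a where a: "a \<in> S" "\<And>s. s \<in> S \<Longrightarrow> s \<le> a"
    using compact_attains_sup[of S] by auto
  have a': "0 \<le> a" "a \<le> t" "\<phi> a \<le> \<phi> t / 2" using a(1) by (auto simp: S_def)
  have "continuous_on {a..t} \<phi>"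
    by (rule continuous_on_subset[OF cont]) (use a' in auto)
  then obtain b where b: "a \<le> b" "b \<le> t" "\<phi> b = \<phi> t / 2"
    using IVT'[of \<phi> a "\<phi> t / 2" t] a' pos by auto
  then have "b = a" using a(2)[of b] a' by (auto simp: S_def)
  then have "\<phi> a > 0" "a < t" using b pos a' by (auto simp: less_le)
  then obtain h where h: "h > 0" "a + h \<le> t" "\<phi> (a + h) < \<phi> a"
    using dec a' by blast
  then have "a + h \<in> S" using a' by (auto simp: S_def)
  then show False using a(2) h(1) by fastforce
qed

lemma uniform_steps_if_interior:
  fixes C :: "(real ^ 'n::finite) set"
  assumes C: "closed C" and v: "v \<in> interior (clarke_tangent_cone_at_inf I C)"
  obtains \<epsilon> R l where "\<epsilon> > 0" "R > 0" "l > 0"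
    "\<And>x t v'. x \<in> C \<Longrightarrow> norm (coord_proj I x) > R \<Longrightarrow> 0 \<le> t \<Longrightarrow> t \<le> l \<Longrightarrow> v' \<in> cball v \<epsilon> \<Longrightarrow>
       x + t *\<^sub>R v' \<in> C"
proof -
  obtain \<delta> where \<delta>: "\<delta> > 0" "cball v \<delta> \<subseteq> clarke_tangent_cone_at_inf I C"
    using v by (auto simp: mem_interior_cball)
  obtain R l where l: "l > 0"
    and step: "\<And>u x t. u \<in> cball v \<delta> \<Longrightarrow> x \<in> C \<Longrightarrow> norm (coord_proj I x) > R \<Longrightarrow> 0 < t \<Longrightarrow> t \<le> l \<Longrightarrow>
       \<exists>w. dist w u \<le> \<delta> / 2 \<and> x + t *\<^sub>R w \<in> C"
    by (rule clarke_tangent_cone_uniform[OF compact_cball \<delta>(2) half_gt_zero[OF \<delta>(1)]]) blast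
  define B where "B = norm v + \<delta>"
  have B: "B > 0" using \<delta>(1) by (simp add: B_def add_nonneg_pos)
  \<comment> \<open>The bound \<open>1\<close> on \<open>t\<close> is a free choice, since
    \<open>l\<close> limits only the auxiliary steps from nearest points. For such \<open>t\<close>
    the segment stays within \<open>B\<close> of \<open>x\<close> and its nearest points in
    \<open>C\<close> within \<open>2 * B\<close>, so they remain beyond \<open>R\<close>. The
    absolute value makes the new radius positive.\<close>
  show thesis
  proof (rule that[of "\<delta> / 4" "\<bar>R\<bar> + 2 * B" 1])
    fix x v' :: "real ^ 'n" and t :: real
    assume x: "x \<in> C" "norm (coord_proj I x) > \<bar>R\<bar> + 2 * B"
      and t: "0 \<le> t" "t \<le> 1" and v': "v' \<in> cball v (\<delta> / 4)"
    define \<phi> where "\<phi> s = infdist (x + s *\<^sub>R v') C" for s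
    have "norm v' \<le> norm v + norm (v' - v)"
      using norm_triangle_ineq[of v "v' - v"] by simp
    then have v'B: "norm v' \<le> B"
      using v' \<delta>(1) by (simp add: B_def dist_norm norm_minus_commute)
    have "\<phi> t \<le> 0"
    proof (rule nonpos_if_decreasing_where_pos[OF t(1)])
      show "continuous_on {0..t} \<phi>"
        unfolding \<phi>_def by (intro continuous_intros)
      show "\<phi> 0 \<le> 0" using x by (simp add: \<phi>_def)
      fix s assume s: "0 \<le> s" "s < t" "\<phi> s > 0"
      define y where "y = x + s *\<^sub>R v'"
      obtain z where z: "z \<in> C" "infdist y C = dist y z"
        using infdist_attains_inf[OF C, of y] x by auto
      have y: "y \<notin> C" using s(3) by (auto simp: \<phi>_def y_def)
      have "dist x y \<le> B"
        using mult_mono[of s 1 "norm v'" B] s t v'B B by (simp add: y_def dist_norm)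
      moreover have "dist y z \<le> dist x y"
        using infdist_le[OF x(1), of y] z(2) by (simp add: dist_commute)
      ultimately have "dist x z \<le> 2 * B"
        using dist_triangle[of x z y] by simp
      then have far: "norm (coord_proj I z) > R"
        using norm_coord_proj_le_add_dist[of I x z] x(2) by simp
      have "(y - z) \<bullet> v' < 0"
      proof (rule inner_neg_of_nearest_point[OF z(1) y _ \<delta>(1) l _ v'])
        show "norm (y - z) \<le> norm (y - c)" if "c \<in> C" for c
          using infdist_le[OF that, of y] z(2) by (simp add: dist_norm)
      qed (use step z(1) far in blast)
      \<comment> \<open>A short move along \<open>v'\<close> brings \<open>y\<close> closer to the
        fixed point \<open>z\<close>, whose distance bounds the distance to \<open>C\<close> from
        above.\<close>
      then have "(z - y) \<bullet> v' > 0" by (simp add: inner_diff_left)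
      from closer_points_lemma[OF this] obtain h where
        h: "h > 0" "\<And>k. 0 < k \<Longrightarrow> k \<le> h \<Longrightarrow> norm (k *\<^sub>R v' - (z - y)) < norm (z - y)"
        by blast
      define k where "k = min h (t - s)"
      have k: "0 < k" "k \<le> h" "s + k \<le> t" using h(1) s by (auto simp: k_def)
      have "\<phi> (s + k) \<le> dist (x + (s + k) *\<^sub>R v') z"
        unfolding \<phi>_def by (rule infdist_le[OF z(1)])
      also have "\<dots> = norm (k *\<^sub>R v' - (z - y))"
        by (simp add: dist_norm y_def algebra_simps)
      also have "\<dots> < \<phi> s"
        using h(2)[OF k(1,2)] z(2) by (simp add: \<phi>_def y_def dist_norm norm_minus_commute)
      finally show "\<exists>h>0. s + h \<le> t \<and> \<phi> (s + h) < \<phi> s" using k by blast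
    qed
    then have "infdist (x + t *\<^sub>R v') C = 0"
      using infdist_nonneg[of "x + t *\<^sub>R v'" C] by (simp add: \<phi>_def)
    then show "x + t *\<^sub>R v' \<in> C"
      using in_closed_iff_infdist_zero[OF C] x(1) by auto
  qed (use \<delta> B in auto)
qed

text \<open>The constant sequence \<open>u\<close> is admissible from some index on, because the
  base points leave every cylinder and the steps drop below \<open>l\<close>.\<close>

lemma clarke_tangent_cone_if_uniform_steps:
  assumes "l > 0"
    and step: "\<And>x t. x \<in> C \<Longrightarrow> norm (coord_proj I x) > R \<Longrightarrow> 0 < t \<Longrightarrow> t \<le> l \<Longrightarrow> x + t *\<^sub>R u \<in> C"
  shows "u \<in> clarke_tangent_cone_at_inf I C"
  unfolding clarke_tangent_cone_at_inf_def
proof (intro CollectI allI impI, elim conjE)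
  fix x t
  assume x: "\<forall>k. x k \<in> C" "filterlim (\<lambda>k. norm (coord_proj I (x k))) at_top sequentially"
    and t: "decreases_to_zero t"
  \<comment> \<open>At the finitely many indices where \<open>u\<close> fails, the value
    \<open>0\<close> keeps the point at \<open>x k\<close>, which lies in \<open>C\<close>.\<close>
  define w where "w k = (if x k + t k *\<^sub>R u \<in> C then u else 0)" for k
  have "\<forall>\<^sub>F k in sequentially. norm (coord_proj I (x k)) > R"
    using x(2) by (simp add: filterlim_at_top_dense)
  moreover have "\<forall>\<^sub>F k in sequentially. t k < l"
    using t \<open>l > 0\<close> unfolding decreases_to_zero_def by (auto dest: order_tendstoD(2))
  ultimately have "\<forall>\<^sub>F k in sequentially. w k = u"
    by eventually_elim (use x t step in \<open>auto simp: w_def decreases_to_zero_def\<close>)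
  then have "w \<longlonglongrightarrow> u"
    by (rule tendsto_eventually)
  moreover have "\<forall>k. x k + t k *\<^sub>R w k \<in> C"
    using x(1) by (simp add: w_def)
  ultimately show "\<exists>w. w \<longlonglongrightarrow> u \<and> (\<forall>k. x k + t k *\<^sub>R w k \<in> C)"
    by blast
qed

theorem theorem3p6:
  fixes C :: "(real ^ 'n::finite) set" and I :: "'n set" and v :: "real ^ 'n"
  assumes "closed C"
    and "I \<noteq> {}"
    and "\<not> bounded (coord_proj I ` C)"
  shows "v \<in> interior (clarke_tangent_cone_at_inf I C) \<longleftrightarrow>
    (\<exists>\<epsilon> R l. \<epsilon> > 0 \<and> R > 0 \<and> l > 0 \<and>
      (\<forall>x \<in> C - cyl_ball R I. \<forall>t \<in> {0..l}. \<forall>v' \<in> cball v \<epsilon>. x + t *\<^sub>R v' \<in> C))"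
    (is "_ \<longleftrightarrow> ?rhs")
proof
  assume "v \<in> interior (clarke_tangent_cone_at_inf I C)"
  from uniform_steps_if_interior[OF assms(1) this] obtain \<epsilon> R l where
    "\<epsilon> > 0" "R > 0" "l > 0"
    "\<And>x t v'. x \<in> C \<Longrightarrow> norm (coord_proj I x) > R \<Longrightarrow> 0 \<le> t \<Longrightarrow> t \<le> l \<Longrightarrow> v' \<in> cball v \<epsilon> \<Longrightarrow>
       x + t *\<^sub>R v' \<in> C"
    by blast
  then show ?rhs
    by (intro exI[of _ \<epsilon>] exI[of _ R] exI[of _ l]) (simp add: cyl_ball_def)
next
  assume ?rhs
  then obtain \<epsilon> R l where "\<epsilon> > 0" "l > 0"
    and step: "\<forall>x \<in> C - cyl_ball R I. \<forall>t \<in> {0..l}. \<forall>v' \<in> cball v \<epsilon>. x + t *\<^sub>R v' \<in> C"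
    by blast
  have "u \<in> clarke_tangent_cone_at_inf I C" if "u \<in> cball v \<epsilon>" for u
    by (rule clarke_tangent_cone_if_uniform_steps[where R = R, OF \<open>l > 0\<close>])
      (use step that in \<open>auto simp: cyl_ball_def\<close>)
  then show "v \<in> interior (clarke_tangent_cone_at_inf I C)"
    using \<open>\<epsilon> > 0\<close> unfolding mem_interior_cball by blast
qed

end
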